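(* Let $k$ and $\ell$ be two integers such that $k>3$ and $\ell \in \{2,\ldots,k-2\}$. The graph $C_{k,\ell}$ is balanceable if and only if $k$ is even and $(k,\ell) \notin \{(6,2),(6,4)\}$.
   Context: All graphs are simple and finite. For integers $k>3$ and $\ell\in\{2,\ldots,k-2\}$, $C_{k,\ell}$ is the simple graph with vertices $u_0,\ldots,u_{k-1}$ in which, for every $i$, $u_i$ is adjacent to $u_{i+1}$ and to $u_{i+\ell}$ (indices modulo $k$); that is, the cycle $C_k$ with all chords $u_iu_{i+\ell}$ added (so $C_{k,\ell}=C_{k,k-\ell}$). A 2-coloring of the edges of $K_n$ is a function $\alpha:E(K_n)\to\{R,B\}$. It contains a balanced copy of a graph $G$ if $K_n$ has a (not necessarily induced) subgraph isomorphic to $G$ whose edge set is partitioned into $E_1,E_2$ with $\alpha(e)=R$ for $e\in E_1$, $\alpha(e)=B$ for $e\in E_2$, and $\big||E_1|-|E_2|\big|\le 1$. A graph $G$ is balanceable if there is an $n_0$ such that for every $n\ge n_0$ there exists an integer $m$ with $0\le m<\lfloor \frac12\binom n2\rfloor$ such that every 2-coloring $\alpha$ of $E(K_n)$ with $|\alpha^{-1}(R)|>m$ and $|\alpha^{-1}(B)|>m$ contains a balanced copy of $G$. *)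

theory Defs
  imports "HOL-Library.Ramsey"
begin

text \<open>
  A graph is a pair of a vertex set and a set of edges, each edge being a two-element set of
  vertices.  The set of two-element subsets of \<open>V\<close> is \<open>[V]\<^bsup>2\<^esup>\<close> (\<^const>\<open>nsets\<close>).
\<close>

type_synonym 'a ugraph = "'a set \<times> 'a set set"

abbreviation verts :: "'a ugraph \<Rightarrow> 'a set" where
  "verts \<equiv> fst"

abbreviation edges :: "'a ugraph \<Rightarrow> 'a set set" where
  "edges \<equiv> snd"

definition simple_graph :: "'a ugraph \<Rightarrow> bool" where
  "simple_graph G \<longleftrightarrow> finite (verts G) \<and> edges G \<subseteq> [verts G]\<^bsup>2\<^esup>"

definition subgraph :: "'a ugraph \<Rightarrow> 'a ugraph \<Rightarrow> bool" where
  "subgraph H G \<longleftrightarrow> simple_graph H \<and> verts H \<subseteq> verts G \<and> edges H \<subseteq> edges G"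

definition graph_iso :: "'a ugraph \<Rightarrow> 'b ugraph \<Rightarrow> bool" where
  "graph_iso G H \<longleftrightarrow>
     (\<exists>f. bij_betw f (verts G) (verts H) \<and>
          (\<forall>u\<in>verts G. \<forall>v\<in>verts G. {u, v} \<in> edges G \<longleftrightarrow> {f u, f v} \<in> edges H))"

definition complete_graph :: "nat \<Rightarrow> nat ugraph" where
  "complete_graph n = ({..<n}, [{..<n}]\<^bsup>2\<^esup>)"

text \<open>
  \<open>chorded_cycle k l\<close> is the graph $C_{k,l}$.  The two edge families overlap when
  \<open>k = 2 * l\<close>: the chord from \<open>i\<close> then coincides with the chord from \<open>i + l\<close>.
\<close>

definition chorded_cycle :: "nat \<Rightarrow> nat \<Rightarrow> nat ugraph" where
  "chorded_cycle k l =
     ({..<k}, (\<lambda>i. {i, (i + 1) mod k}) ` {..<k} \<union> (\<lambda>i. {i, (i + l) mod k}) ` {..<k})"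

datatype colour = Red | Blue

text \<open>
  A colouring is a function on all sets of vertices; only its values on the edges of the
  complete graph are ever used.
\<close>

definition colour_class :: "nat \<Rightarrow> (nat set \<Rightarrow> colour) \<Rightarrow> colour \<Rightarrow> nat set set" where
  "colour_class n \<alpha> c = {e \<in> edges (complete_graph n). \<alpha> e = c}"

definition contains_balanced_copy :: "nat \<Rightarrow> (nat set \<Rightarrow> colour) \<Rightarrow> 'a ugraph \<Rightarrow> bool" where
  "contains_balanced_copy n \<alpha> G \<longleftrightarrow>
     (\<exists>H. subgraph H (complete_graph n) \<and> graph_iso G H \<and>
        (\<exists>E1 E2. E1 \<union> E2 = edges H \<and> E1 \<inter> E2 = {} \<and>
           (\<forall>e\<in>E1. \<alpha> e = Red) \<and> (\<forall>e\<in>E2. \<alpha> e = Blue) \<and>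
           \<bar>int (card E1) - int (card E2)\<bar> \<le> 1))"

definition balanceable :: "'a ugraph \<Rightarrow> bool" where
  "balanceable G \<longleftrightarrow>
     (\<exists>n0. \<forall>n\<ge>n0. \<exists>m::nat. m < (n choose 2) div 2 \<and>
        (\<forall>\<alpha>. card (colour_class n \<alpha> Red) > m \<and> card (colour_class n \<alpha> Blue) > m
              \<longrightarrow> contains_balanced_copy n \<alpha> G))"

lemma simple_graph_complete_graph: "simple_graph (complete_graph n)"
  by (simp add: simple_graph_def complete_graph_def)

lemma card_edges_complete_graph: "card (edges (complete_graph n)) = n choose 2"
  by (simp add: complete_graph_def)

lemma mod_shift_neq:
  fixes i l k :: nat
  assumes "i < k" "0 < l" "l < k"
  shows "(i + l) mod k \<noteq> i"
  using assms by (cases "i + l < k") (auto simp: mod_if)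

lemma simple_graph_chorded_cycle:
  assumes "k > 3" "l \<in> {2..k - 2}"
  shows "simple_graph (chorded_cycle k l)"
  using assms mod_shift_neq[of _ k 1] mod_shift_neq[of _ k l]
  by (fastforce simp: simple_graph_def chorded_cycle_def)

end

theory Submission
  imports Defs
begin

text \<open>
  A graph \<open>G\<close> is balanceable if and only if it has a vertex set whose edge cut contains half of
  the edges of \<open>G\<close> and a vertex set that induces half of them.  For necessity, consider the
  colourings of the complete graph whose red class is a cut, or the edge set of a clique, having
  exactly half of the edges; such colourings exist for arbitrarily large \<open>n\<close>.  For sufficiency,
  partition all but boundedly many vertices into large monochromatic cliques by Ramsey's theorem.
  If the cliques have different colours, the pairs between two of them are dense in some colour;
  if they all have the same colour, half of all edges have the other colour, so that colour has
  positive density between two of the cliques.  The Kovari-Sos-Turan argument then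
  gives disjoint monochromatic sets \<open>A\<close>, \<open>B\<close> such that the edges between them have a common
  colour, different from that of \<open>A\<close>; mapping one of the two vertex sets of \<open>G\<close> into \<open>A\<close> and the
  rest into \<open>B\<close> gives a balanced copy.

  For \<open>C\<^sub>k\<^sub>,\<^sub>l\<close> with \<open>k \<noteq> 2 l\<close>, which is 4-regular with \<open>2 k\<close> edges, a set \<open>U\<close> inducing \<open>e\<close> edges
  has a cut of size \<open>4 |U| - 2 e\<close>, and its complement induces \<open>2 k - 4 |U| + e\<close> edges.  Cuts are even,
  which excludes odd \<open>k\<close>; no vertex set of the octahedron \<open>C\<^sub>6\<^sub>,\<^sub>2\<close> induces 6 edges.  In the
  remaining cases suitable sets \<open>U\<close> are intervals with at most two extra vertices, or sets of even
  vertices.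
\<close>

section \<open>Embeddings and halves of the edge set\<close>

text \<open>In a finite graph, for \<open>F \<subseteq> edges G\<close>, this is the balance
  condition for \<open>F\<close> and the remaining edges, stated through \<open>F\<close>
  alone.\<close>

definition half_edges :: "'a ugraph \<Rightarrow> 'a set set \<Rightarrow> bool" where
  "half_edges G F \<longleftrightarrow> \<bar>2 * int (card F) - int (card (edges G))\<bar> \<le> 1"

definition cut_edges :: "'a ugraph \<Rightarrow> 'a set \<Rightarrow> 'a set set" where
  "cut_edges G W = {e \<in> edges G. e \<inter> W \<noteq> {} \<and> \<not> e \<subseteq> W}"

definition inner_edges :: "'a ugraph \<Rightarrow> 'a set \<Rightarrow> 'a set set" where
  "inner_edges G W = {e \<in> edges G. e \<subseteq> W}"

lemma finite_edges: "simple_graph G \<Longrightarrow> finite (edges G)"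
  unfolding simple_graph_def by (meson finite_imp_finite_nsets finite_subset)

lemma edges_subset_Pow: "simple_graph G \<Longrightarrow> edges G \<subseteq> Pow (verts G)"
  by (auto simp: simple_graph_def nsets_def)

lemma half_edges_Diff:
  assumes "finite (edges G)" "F \<subseteq> edges G"
  shows "half_edges G (edges G - F) \<longleftrightarrow> half_edges G F"
proof -
  have "card (edges G - F) = card (edges G) - card F" "card F \<le> card (edges G)"
    using assms by (auto simp: card_Diff_subset finite_subset card_mono)
  thus ?thesis unfolding half_edges_def by linarith
qed

lemma edge_cases:
  assumes "simple_graph G" "e \<in> edges G"
  obtains u v where "e = {u, v}" "u \<noteq> v" "u \<in> verts G" "v \<in> verts G"
  using assms unfolding simple_graph_def nsets_2_eq by blast

lemma not_Red_iff: "c \<noteq> Red \<longleftrightarrow> c = Blue"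
  by (cases c) auto

text \<open>An injection on the vertices is injective on the edges too, so colour counts pull back
  from the copy to \<open>G\<close>, and later arguments need only embeddings.\<close>

lemma contains_balanced_copy_iff:
  assumes G: "simple_graph G"
  shows "contains_balanced_copy n \<alpha> G \<longleftrightarrow>
    (\<exists>f. inj_on f (verts G) \<and> f ` verts G \<subseteq> {..<n} \<and>
         half_edges G {e \<in> edges G. \<alpha> (f ` e) = Red})" (is "_ \<longleftrightarrow> ?R")
proof
  assume "contains_balanced_copy n \<alpha> G"
  then obtain H f E1 E2 where H: "subgraph H (complete_graph n)"
    and f: "bij_betw f (verts G) (verts H)"
    and fe: "\<forall>u\<in>verts G. \<forall>v\<in>verts G. {u, v} \<in> edges G \<longleftrightarrow> {f u, f v} \<in> edges H"
    and E: "E1 \<union> E2 = edges H" "E1 \<inter> E2 = {}" "\<forall>e\<in>E1. \<alpha> e = Red" "\<forall>e\<in>E2. \<alpha> e = Blue"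
    and d: "\<bar>int (card E1) - int (card E2)\<bar> \<le> 1"
    unfolding contains_balanced_copy_def graph_iso_def by blast
  have sH: "simple_graph H" using H by (simp add: subgraph_def)
  have inj: "inj_on f (verts G)" and im: "f ` verts G = verts H"
    using f by (auto simp: bij_betw_def)
  have EV: "edges G \<subseteq> Pow (verts G)" by (rule edges_subset_Pow[OF G])
  have injE: "inj_on ((`) f) (edges G)" 
    by (rule inj_on_subset[OF inj_on_image_Pow[OF inj] EV])
  have imE: "(`) f ` edges G = edges H"
  proof
    show "(`) f ` edges G \<subseteq> edges H"
      using fe edge_cases[OF G] by (smt (verit) image_empty image_insert image_subsetI)
    show "edges H \<subseteq> (`) f ` edges G"
    proof
      fix e assume e: "e \<in> edges H"
      then obtain x y where xy: "e = {x, y}" "x \<in> verts H" "y \<in> verts H"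
        using edge_cases[OF sH] by metis
      then obtain u v where uv: "x = f u" "y = f v" "u \<in> verts G" "v \<in> verts G" using im by blast
      hence "{u, v} \<in> edges G" using fe e xy by blast
      thus "e \<in> (`) f ` edges G" using xy uv by (intro image_eqI[of _ _ "{u, v}"]) auto
    qed
  qed
  have "E1 = {e \<in> edges H. \<alpha> e = Red}"
    using E by force
  also have "\<dots> = (`) f ` {e \<in> edges G. \<alpha> (f ` e) = Red}"
    unfolding imE[symmetric] by blast
  finally have c1: "card {e \<in> edges G. \<alpha> (f ` e) = Red} = card E1"
    using card_image[OF inj_on_subset[OF injE]] by simp
  have "card (edges G) = card (edges H)" using card_image[OF injE] imE by simp
  also have "\<dots> = card E1 + card E2"
    using E finite_edges[OF sH] by (metis card_Un_disjoint finite_Un)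
  finally have "half_edges G {e \<in> edges G. \<alpha> (f ` e) = Red}"
    using c1 d by (simp add: half_edges_def)
  moreover have "f ` verts G \<subseteq> {..<n}" using H im by (simp add: subgraph_def complete_graph_def)
  ultimately show ?R using inj by blast
next
  assume ?R
  then obtain f where inj: "inj_on f (verts G)" and sub: "f ` verts G \<subseteq> {..<n}"
    and half: "half_edges G {e \<in> edges G. \<alpha> (f ` e) = Red}" by blast
  define H where "H = (f ` verts G, (`) f ` edges G)"
  have EV: "edges G \<subseteq> Pow (verts G)" by (rule edges_subset_Pow[OF G])
  have injE: "inj_on ((`) f) (edges G)"
    by (rule inj_on_subset[OF inj_on_image_Pow[OF inj] EV])
  have ns: "(`) f ` edges G \<subseteq> [f ` verts G]\<^bsup>2\<^esup>"
  proof
    fix e assume "e \<in> (`) f ` edges G"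
    then obtain u v where "e = {f u, f v}" "u \<noteq> v" "u \<in> verts G" "v \<in> verts G"
      using edge_cases[OF G] by (smt (verit) image_empty image_iff image_insert)
    moreover from this have "f u \<noteq> f v" using inj by (meson inj_onD)
    ultimately show "e \<in> [f ` verts G]\<^bsup>2\<^esup>" by (simp add: nsets_def)
  qed
  have "subgraph H (complete_graph n)"
    unfolding subgraph_def simple_graph_def complete_graph_def H_def
    using ns sub G nsets_mono[OF sub, of 2] by (auto simp: simple_graph_def)
  moreover have "graph_iso G H"
    unfolding graph_iso_def H_def
  proof (intro exI[of _ f] conjI ballI)
    fix u v assume uv: "u \<in> verts G" "v \<in> verts G"
    have "{f u, f v} \<in> (`) f ` edges G \<longleftrightarrow> f ` {u, v} \<in> (`) f ` edges G" by simp
    also have "\<dots> \<longleftrightarrow> {u, v} \<in> edges G"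
      using inj_on_image_mem_iff[OF inj_on_image_Pow[OF inj] _ EV, of "{u, v}"] uv by simp
    finally show "({u, v} \<in> edges G) = ({f u, f v} \<in> edges (f ` verts G, (`) f ` edges G))" by simp
  qed (use inj in \<open>simp add: bij_betw_def\<close>)
  moreover have "\<bar>int (card {e \<in> edges H. \<alpha> e = Red}) - int (card {e \<in> edges H. \<alpha> e = Blue})\<bar> \<le> 1"
  proof -
    have c: "card {e \<in> edges H. \<alpha> e = c} = card {e \<in> edges G. \<alpha> (f ` e) = c}" for c
    proof -
      have "{e \<in> edges H. \<alpha> e = c} = (`) f ` {e \<in> edges G. \<alpha> (f ` e) = c}"
        by (auto simp: H_def)
      thus ?thesis using card_image[OF inj_on_subset[OF injE]] by simp
    qed
    have "{e \<in> edges G. \<alpha> (f ` e) = Blue} = edges G - {e \<in> edges G. \<alpha> (f ` e) = Red}"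
      by (auto simp flip: not_Red_iff)
    hence "card {e \<in> edges G. \<alpha> (f ` e) = Blue}
      = card (edges G) - card {e \<in> edges G. \<alpha> (f ` e) = Red}"
      using finite_edges[OF G] by (simp add: card_Diff_subset)
    moreover have "card {e \<in> edges G. \<alpha> (f ` e) = Red} \<le> card (edges G)"
      using finite_edges[OF G] by (intro card_mono) auto
    ultimately show ?thesis using half unfolding c half_edges_def by linarith
  qed
  moreover have "{e \<in> edges H. \<alpha> e = Red} \<union> {e \<in> edges H. \<alpha> e = Blue} = edges H"
    by (auto simp flip: not_Red_iff)
  ultimately show "contains_balanced_copy n \<alpha> G"
    unfolding contains_balanced_copy_def
    by (intro exI[of _ H] conjI exI[of _ "{e \<in> edges H. \<alpha> e = Red}"] exI[of _ "{e \<in> edges H. \<alpha> e = Blue}"]) auto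
qed

section \<open>Unavoidable patterns\<close>

text \<open>Averaging: deleting an element of least weight does not lower the mean weight; this is
  repeated until \<open>s\<close> elements are left.\<close>

lemma weighted_subset:
  fixes w :: "'a \<Rightarrow> nat"
  assumes "finite A" "s \<le> card A"
  shows "\<exists>S\<subseteq>A. card S = s \<and> s * sum w A \<le> card A * sum w S"
  using assms
proof (induction "card A - s" arbitrary: A)
  case 0
  thus ?case by (intro exI[of _ A]) auto
next
  case (Suc d)
  have "A \<noteq> {}" using Suc.hyps(2) by auto
  then obtain a where a: "a \<in> A" "\<And>x. x \<in> A \<Longrightarrow> w a \<le> w x"
    using arg_min_if_finite[OF Suc.prems(1), of w] by (metis linorder_not_less)
  let ?B = "A - {a}"
  have cA: "card A = Suc (card ?B)" using a(1) Suc.prems(1) by (metis card.remove)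
  obtain S where S: "S \<subseteq> ?B" "card S = s" "s * sum w ?B \<le> card ?B * sum w S"
    using Suc.hyps(1)[of ?B] Suc.hyps(2) Suc.prems cA
    proof -
      have "d = card ?B - s" "s \<le> card ?B" using Suc.hyps(2) cA by linarith+
      with that show ?thesis using Suc.hyps(1)[of ?B] Suc.prems(1) by blast
    qed
  have sA: "sum w A = w a + sum w ?B" using a(1) Suc.prems(1) by (simp add: sum.remove)
  show ?case
  proof (cases "card ?B = 0")
    case True
    then have "s = 0" using Suc.hyps(2) cA by linarith
    thus ?thesis by (intro exI[of _ "{}"]) auto
  next
    case False
    have "card ?B * w a \<le> sum w ?B" using a(2) using sum_bounded_below[of ?B "w a" w] by simp
    hence "card ?B * sum w A \<le> card A * sum w ?B" unfolding sA cA by (simp add: algebra_simps)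
    hence "card ?B * (s * sum w A) \<le> card A * (s * sum w ?B)"
      using mult_le_mono2[of _ _ s] by (metis mult.left_commute)
    also have "\<dots> \<le> card A * (card ?B * sum w S)" using S(3) by simp
    finally have "card ?B * (s * sum w A) \<le> card ?B * (card A * sum w S)" by (simp add: ac_simps)
    hence "s * sum w A \<le> card A * sum w S" using False by (metis mult_le_cancel1 neq0_conv)
    thus ?thesis using S by blast
  qed
qed

text \<open>Kovari-Sos-Turan at density 1/4. Some \<open>8 * t\<close> vertices of \<open>A\<close>
  with at least the mean degree of \<open>A\<close> send at least \<open>2 * t * T\<close> edges to
  \<open>B\<close>. Vertices of \<open>B\<close> with fewer than \<open>t\<close> neighbours among
  them absorb at most \<open>t * T\<close> of these, so at least \<open>T / 8\<close> vertices of
  \<open>B\<close> have \<open>t\<close> such neighbours.\<close>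

lemma dense_bipartite_biclique:
  fixes P :: "'a \<Rightarrow> 'b \<Rightarrow> bool"
  assumes "finite A" "card A = T" "finite B" "card B = T"
    and T: "8 * t * 2 ^ (8 * t) \<le> T" and t: "t > 0"
    and dense: "T\<^sup>2 \<le> 4 * card {(a, b). a \<in> A \<and> b \<in> B \<and> P a b}"
  shows "\<exists>A'\<subseteq>A. \<exists>B'\<subseteq>B. card A' = t \<and> card B' = t \<and> (\<forall>a\<in>A'. \<forall>b\<in>B'. P a b)"
proof -
  have "8 * t * 1 \<le> 8 * t * 2 ^ (8 * t)" by (intro mult_le_mono2) simp
  hence tT: "8 * t \<le> T" using T by linarith
  define w where "w = (\<lambda>a. card {b\<in>B. P a b})"
  have "{(a, b). a \<in> A \<and> b \<in> B \<and> P a b} = Sigma A (\<lambda>a. {b\<in>B. P a b})" by auto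
  hence "card {(a, b). a \<in> A \<and> b \<in> B \<and> P a b} = sum w A"
    using assms(1,3) unfolding w_def by (simp add: card_SigmaI)
  hence wA: "T\<^sup>2 \<le> 4 * sum w A" using dense by simp
  obtain S where S: "S \<subseteq> A" "card S = 8 * t" "8 * t * sum w A \<le> T * sum w S"
    using weighted_subset[of A "8 * t" w] assms tT by auto
  have fS: "finite S" using S(1) assms(1) finite_subset by auto
  have "T * (2 * t * T) = 2 * t * T\<^sup>2" by (simp add: power2_eq_square)
  also have "\<dots> \<le> 2 * t * (4 * sum w A)" using wA by (rule mult_le_mono2)
  also have "\<dots> = 8 * t * sum w A" by simp
  also note S(3)
  finally have "2 * t * T \<le> sum w S" using tT t by (simp add: mult_le_cancel1)
  also have "sum w S = (\<Sum>b\<in>B. card {a\<in>S. P a b})"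
    unfolding w_def using fS assms(3) by (rule sum_multicount_gen) simp
  finally have deg: "2 * t * T \<le> (\<Sum>b\<in>B. card {a\<in>S. P a b})" .
  define G where "G = {b\<in>B. t \<le> card {a\<in>S. P a b}}"
  have fG: "finite G" using assms(3) by (simp add: G_def)
  have "(\<Sum>b\<in>B. card {a\<in>S. P a b}) \<le> (\<Sum>b\<in>B. t + (if b \<in> G then 8 * t else 0))"
  proof (rule sum_mono)
    fix b assume "b \<in> B"
    have "card {a\<in>S. P a b} \<le> card S" using fS by (intro card_mono) auto
    thus "card {a\<in>S. P a b} \<le> t + (if b \<in> G then 8 * t else 0)"
      using S(2) \<open>b \<in> B\<close> by (auto simp: G_def)
  qed
  also have "\<dots> = T * t + card (B \<inter> G) * (8 * t)"
    using assms(3,4) by (simp add: sum.distrib sum.If_cases)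
  also have "B \<inter> G = G" by (auto simp: G_def)
  finally have "2 * t * T \<le> T * t + card G * (8 * t)" using deg by linarith
  hence "t * T \<le> t * (8 * card G)" by (simp add: algebra_simps)
  hence cG: "T \<le> 8 * card G" using t by simp
  txt \<open>Restricting to the \<open>8 t\<close> vertices of \<open>S\<close> bounds the number of possible neighbourhoods
    independently of \<open>T\<close>, so that many vertices of \<open>G\<close> choose the same \<open>t\<close> neighbours.\<close>
  define g where "g b = (SOME X. X \<subseteq> {a\<in>S. P a b} \<and> card X = t)" for b
  have g: "g b \<subseteq> {a\<in>S. P a b}" "card (g b) = t" if "b \<in> G" for b
  proof -
    have "\<exists>X. X \<subseteq> {a\<in>S. P a b} \<and> card X = t"
      using that obtain_subset_with_card_n unfolding G_def by (metis (no_types, lifting) mem_Collect_eq)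
    from someI_ex[OF this] show "g b \<subseteq> {a\<in>S. P a b}" "card (g b) = t" unfolding g_def by auto
  qed
  obtain X where X: "X \<in> Pow S" "card G \<le> card (g -` {X} \<inter> G) * card (Pow S)"
    using pigeonhole_card[of g G "Pow S"] fG fS g(1) by force
  let ?F = "g -` {X} \<inter> G"
  have "t * 2 ^ (8 * t) \<le> card G" using T cG by simp
  also have "\<dots> \<le> card ?F * 2 ^ (8 * t)" using X(2) by (simp add: card_Pow fS S(2))
  finally have tF: "t \<le> card ?F" by simp
  then obtain B' where B': "B' \<subseteq> ?F" "card B' = t" using obtain_subset_with_card_n by metis
  then obtain b where b: "b \<in> ?F" using t by (metis card.empty ex_in_conv less_irrefl subset_empty tF le_zero_eq)
  have "X \<subseteq> A" "card X = t" using X(1) S(1) g[of b] b by auto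
  moreover have "B' \<subseteq> B" using B'(1) by (auto simp: G_def)
  moreover have "\<forall>a\<in>X. \<forall>b\<in>B'. P a b" using B'(1) g(1) by fastforce
  ultimately show ?thesis using B'(2) by blast
qed

definition unicoloured :: "('a set \<Rightarrow> colour) \<Rightarrow> colour \<Rightarrow> 'a set \<Rightarrow> bool" where
  "unicoloured \<alpha> c A \<longleftrightarrow> (\<forall>x\<in>A. \<forall>y\<in>A. x \<noteq> y \<longrightarrow> \<alpha> {x, y} = c)"

lemma unicoloured_subset: "unicoloured \<alpha> c A \<Longrightarrow> B \<subseteq> A \<Longrightarrow> unicoloured \<alpha> c B"
  unfolding unicoloured_def by blast

text \<open>Ramsey's theorem is applied greedily: as long as \<open>r\<close> vertices remain, a set
  of size \<open>T\<close> is split off. The bound \<open>r\<close> is independent of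
  \<open>\<alpha>\<close> and \<open>V\<close>.\<close>

lemma unicoloured_partition:
  assumes "T > 0"
  shows "\<exists>r. \<forall>(\<alpha> :: 'a set \<Rightarrow> colour) V. finite V \<longrightarrow>
    (\<exists>\<C>. \<Union>\<C> \<subseteq> V \<and> pairwise disjnt \<C> \<and> card (V - \<Union>\<C>) < r \<and>
      (\<forall>A\<in>\<C>. card A = T \<and> (\<exists>c. unicoloured \<alpha> c A)))"
proof -
  obtain r where r: "\<And>(V :: 'a set) E. finite V \<Longrightarrow> card V \<ge> r \<Longrightarrow>
      \<exists>R\<subseteq>V. card R = T \<and> clique R E \<or> card R = T \<and> indep R E"
    using ramsey2[of T T] by metis
  have "\<exists>\<C>. \<Union>\<C> \<subseteq> V \<and> pairwise disjnt \<C> \<and> card (V - \<Union>\<C>) < r \<and>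
      (\<forall>A\<in>\<C>. card A = T \<and> (\<exists>c. unicoloured \<alpha> c A))"
    if "finite V" for \<alpha> :: "'a set \<Rightarrow> colour" and V
    using that
  proof (induction "card V" arbitrary: V rule: less_induct)
    case less
    show ?case
    proof (cases "card V < r")
      case True
      thus ?thesis by (intro exI[of _ "{}"]) auto
    next
      case False
      obtain R where R: "R \<subseteq> V" "card R = T" "clique R {e. \<alpha> e = Red} \<or> indep R {e. \<alpha> e = Red}"
        using r[of V "{e. \<alpha> e = Red}"] less.prems False by (metis linorder_not_less)
      have uR: "\<exists>c. unicoloured \<alpha> c R"
        using R(3) colour.exhaust unfolding unicoloured_def clique_def indep_def mem_Collect_eq by metis
      have fR: "finite R" using R(1) less.prems finite_subset by auto
      have "R \<noteq> {}" using R(2) assms by auto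
      hence "card (V - R) < card V" using R(1) less.prems by (intro psubset_card_mono) auto
      then obtain \<C> where C: "\<Union>\<C> \<subseteq> V - R" "pairwise disjnt \<C>" "card (V - R - \<Union>\<C>) < r"
          "\<forall>A\<in>\<C>. card A = T \<and> (\<exists>c. unicoloured \<alpha> c A)"
        using less.hyps[of "V - R"] less.prems by auto
      have "V - \<Union>(insert R \<C>) = V - R - \<Union>\<C>" by auto
      moreover have "pairwise disjnt (insert R \<C>)"
        using C(1,2) by (auto simp: pairwise_insert disjnt_def)
      ultimately show ?thesis
        using C R(1,2) uR by (intro exI[of _ "insert R \<C>"]) auto
    qed
  qed
  thus ?thesis by blast
qed

text \<open>Two patterns in one: for \<open>c = d\<close> the other colour is complete bipartite
  between \<open>A\<close> and \<open>B\<close>; for \<open>c \<noteq> d\<close> colour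
  \<open>c\<close> is a clique on \<open>A\<close> and all other edges on
  \<open>A \<union> B\<close> have colour \<open>d\<close>.\<close>

definition unavoidable :: "nat \<Rightarrow> nat \<Rightarrow> (nat set \<Rightarrow> colour) \<Rightarrow> bool" where
  "unavoidable n t \<alpha> \<longleftrightarrow> (\<exists>c d A B. A \<subseteq> {..<n} \<and> B \<subseteq> {..<n} \<and> A \<inter> B = {} \<and> card A = t \<and> card B = t \<and>
    unicoloured \<alpha> c A \<and> unicoloured \<alpha> d B \<and> (\<forall>a\<in>A. \<forall>b\<in>B. \<alpha> {a, b} \<noteq> c))"

lemma two_card_colour_class:
  "2 * card (colour_class n \<alpha> c) \<le> card {(x, y). x < n \<and> y < n \<and> x \<noteq> y \<and> \<alpha> {x, y} = c}"
proof -
  define D where "D = {(x, y). x < n \<and> y < n \<and> x < y \<and> \<alpha> {x, y} = c}"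
  have fD: "finite D" by (rule finite_subset[of _ "{..<n} \<times> {..<n}"]) (auto simp: D_def)
  have "colour_class n \<alpha> c \<subseteq> (\<lambda>(x, y). {x, y}) ` D"
  proof
    fix e assume "e \<in> colour_class n \<alpha> c"
    then obtain x y where "e = {x, y}" "x < n" "y < n" "x < y" "\<alpha> e = c"
      unfolding colour_class_def complete_graph_def
      by (auto simp: nsets_2_eq) (metis insert_commute nat_neq_iff)
    thus "e \<in> (\<lambda>(x, y). {x, y}) ` D" unfolding D_def by auto
  qed
  hence 1: "card (colour_class n \<alpha> c) \<le> card D"
    using surj_card_le[OF fD] by blast
  have "{(x, y). x < n \<and> y < n \<and> x \<noteq> y \<and> \<alpha> {x, y} = c} = D \<union> prod.swap ` D"
    by (force simp: D_def insert_commute image_iff)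
  moreover have "D \<inter> prod.swap ` D = {}" by (auto simp: D_def)
  ultimately have "card {(x, y). x < n \<and> y < n \<and> x \<noteq> y \<and> \<alpha> {x, y} = c} = card D + card D"
    using fD by (simp add: card_Un_disjoint card_image)
  thus ?thesis using 1 by simp
qed

lemma two_choose_two: "2 * (n choose 2) = n * (n - 1)"
  by (cases n) (simp_all add: choose_two)

lemma unavoidable_pattern:
  assumes t: "t > 0"
  shows "\<exists>n0. \<forall>n\<ge>n0. \<forall>\<alpha>. (\<forall>c. (n choose 2) div 2 \<le> card (colour_class n \<alpha> c)) \<longrightarrow> unavoidable n t \<alpha>"
proof -
  define T where "T = 8 * t * 2 ^ (8 * t)"
  have T: "T > 0" using t by (simp add: T_def)
  obtain r where r: "\<And>(\<alpha> :: nat set \<Rightarrow> colour) V. finite V \<Longrightarrow>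
    (\<exists>\<C>. \<Union>\<C> \<subseteq> V \<and> pairwise disjnt \<C> \<and> card (V - \<Union>\<C>) < r \<and>
      (\<forall>A\<in>\<C>. card A = T \<and> (\<exists>c. unicoloured \<alpha> c A)))"
    using unicoloured_partition[OF T] by metis
  have "unavoidable n t \<alpha>" if n: "n \<ge> 8 * r + 8"
    and half: "\<And>c. (n choose 2) div 2 \<le> card (colour_class n \<alpha> c)" for n \<alpha>
  proof (rule ccontr)
    assume not: "\<not> unavoidable n t \<alpha>"
    obtain \<C> where C: "\<Union>\<C> \<subseteq> {..<n}" "pairwise disjnt \<C>" "card ({..<n} - \<Union>\<C>) < r"
      "\<And>A. A \<in> \<C> \<Longrightarrow> card A = T" "\<And>A. A \<in> \<C> \<Longrightarrow> \<exists>c. unicoloured \<alpha> c A"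
      using r[of "{..<n}" \<alpha>] by auto
    have fin: "finite A" if "A \<in> \<C>" for A using C(4)[OF that] T card_ge_0_finite by auto
    have fC: "finite \<C>" using C(1) by (meson finite_UnionD finite_lessThan finite_subset)
    define D where "D A B c = {(a, b). a \<in> A \<and> b \<in> B \<and> \<alpha> {a, b} = c}" for A B c
    \<comment> \<open>Next to a clique \<open>A\<close> of colour \<open>c\<close>, a quarter of the
      pairs in the other colour would already yield a biclique and hence the pattern.\<close>
    have sparse: "4 * card (D A B c') < T\<^sup>2"
      if AB: "A \<in> \<C>" "B \<in> \<C>" "A \<noteq> B" and c: "unicoloured \<alpha> c A" "c' \<noteq> c" for A B c c'
    proof (rule ccontr)
      assume "\<not> ?thesis"
      hence dense: "T\<^sup>2 \<le> 4 * card {(a, b). a \<in> A \<and> b \<in> B \<and> \<alpha> {a, b} = c'}" by (simp add: D_def)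
      obtain A' B' where S: "A' \<subseteq> A" "B' \<subseteq> B" "card A' = t" "card B' = t" "\<forall>a\<in>A'. \<forall>b\<in>B'. \<alpha> {a, b} = c'"
        using dense_bipartite_biclique[OF fin[OF AB(1)] C(4)[OF AB(1)] fin[OF AB(2)] C(4)[OF AB(2)] _ t dense]
        unfolding T_def by blast
      obtain d where "unicoloured \<alpha> d B" using C(5) AB by blast
      hence "unicoloured \<alpha> d B'" "unicoloured \<alpha> c A'" using c S unicoloured_subset by auto
      moreover have "A \<inter> B = {}" using pairwiseD[OF C(2) AB] by (simp add: disjnt_def)
      hence "A' \<inter> B' = {}" using S(1,2) by blast
      moreover have "A \<subseteq> {..<n}" "B \<subseteq> {..<n}" using C(1) AB by auto
      hence "A' \<subseteq> {..<n}" "B' \<subseteq> {..<n}" using S(1,2) by auto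
      ultimately have "unavoidable n t \<alpha>" unfolding unavoidable_def using S c(2)
        by (intro exI[of _ c] exI[of _ d] exI[of _ A'] exI[of _ B']) auto
      thus False using not by simp
    qed
    \<comment> \<open>Between cliques of different colours both colours would be sparse, yet
      together they cover all pairs.\<close>
    have same: "c = d" if AB: "A \<in> \<C>" "B \<in> \<C>" "A \<noteq> B"
      and c: "unicoloured \<alpha> c A" "unicoloured \<alpha> d B" for A B c d
    proof (rule ccontr)
      assume cd: "c \<noteq> d"
      have e: "e = c \<or> e = d" for e using cd colour.exhaust by metis
      have "A \<times> B = D A B d \<union> prod.swap ` D B A c"
        using e by (force simp: D_def insert_commute image_iff)
      hence "card (A \<times> B) \<le> card (D A B d) + card (prod.swap ` D B A c)" by (metis card_Un_le)
      hence "T\<^sup>2 \<le> card (D A B d) + card (D B A c)"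
        using C(4) AB by (simp add: card_image power2_eq_square card_cartesian_product)
      thus False using sparse[OF AB c(1), of d] sparse[OF AB(2,1) _ c(2), of c] AB(3) cd by fastforce
    qed
    have "\<exists>c. \<forall>A\<in>\<C>. unicoloured \<alpha> c A"
    proof (cases "\<C> = {}")
      case False
      then obtain A c where "A \<in> \<C>" "unicoloured \<alpha> c A" using C(5) by blast
      thus ?thesis using same C(5) by metis
    qed auto
    then obtain c where c: "\<And>A. A \<in> \<C> \<Longrightarrow> unicoloured \<alpha> c A" by blast
    obtain c' where c': "c' \<noteq> c" by (metis colour.distinct(1))
    define E where "E = {(x, y). x < n \<and> y < n \<and> x \<noteq> y \<and> \<alpha> {x, y} = c'}"
    define L where "L = {..<n} - \<Union>\<C>"
    \<comment> \<open>Diagonal pairs are dropped because \<open>\<alpha>\<close> is arbitrary on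
      singletons; thus \<open>M (A, A)\<close> is empty.\<close>
    define M where "M p = {(a, b) \<in> D (fst p) (snd p) c'. a \<noteq> b}" for p
    have fD: "finite (D A B c')" if "A \<in> \<C>" "B \<in> \<C>" for A B
      by (rule finite_subset[of _ "A \<times> B"]) (use that fin in \<open>auto simp: D_def\<close>)
    have M: "4 * card (M p) \<le> T\<^sup>2" if pC: "p \<in> \<C> \<times> \<C>" for p
    proof -
      obtain A B where p: "p = (A, B)" "A \<in> \<C>" "B \<in> \<C>" using pC by blast
      show ?thesis
      proof (cases "A = B")
        case True
        hence "M p = {}" using c[OF p(2)] c' by (auto simp: M_def D_def p unicoloured_def)
        thus ?thesis by simp
      next
        case False
        have "card (M p) \<le> card (D A B c')"
          unfolding M_def p using fD p by (intro card_mono) auto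
        thus ?thesis using sparse[OF p(2,3) False c[OF p(2)] c'] by linarith
      qed
    qed
    have fM: "finite (M p)" if "p \<in> \<C> \<times> \<C>" for p
    proof -
      have "M p \<subseteq> D (fst p) (snd p) c'" by (auto simp: M_def)
      thus ?thesis using fD that by (metis finite_subset mem_Times_iff)
    qed
    \<comment> \<open>A pair of colour \<open>c'\<close> meets one of the fewer than
      \<open>r\<close> leftover vertices or joins vertices of the cliques, and at most a quarter of
      the latter pairs have this colour.\<close>
    have "E \<subseteq> L \<times> {..<n} \<union> {..<n} \<times> L \<union> (\<Union>p\<in>\<C> \<times> \<C>. M p)"
      unfolding E_def L_def M_def D_def by auto
    hence "card E \<le> card (L \<times> {..<n} \<union> {..<n} \<times> L \<union> (\<Union>p\<in>\<C> \<times> \<C>. M p))"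
      using fC fM by (intro card_mono finite_UnI finite_UN_I) (auto simp: L_def)
    also have "\<dots> \<le> card (L \<times> {..<n} \<union> {..<n} \<times> L) + card (\<Union>p\<in>\<C> \<times> \<C>. M p)"
      by (rule card_Un_le)
    also have "card (L \<times> {..<n} \<union> {..<n} \<times> L) \<le> card (L \<times> {..<n}) + card ({..<n} \<times> L)"
      by (rule card_Un_le)
    also have "\<dots> = 2 * (card L * n)" by (simp add: card_cartesian_product)
    also have "card L * n \<le> r * n" using C(3) by (simp add: L_def)
    also have "card (\<Union>p\<in>\<C> \<times> \<C>. M p) \<le> (\<Sum>p\<in>\<C> \<times> \<C>. card (M p))"
      using fC by (intro card_UN_le) auto
    finally have "4 * card E \<le> 8 * (r * n) + (\<Sum>p\<in>\<C> \<times> \<C>. 4 * card (M p))"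
      by (simp flip: sum_distrib_left)
    also have "(\<Sum>p\<in>\<C> \<times> \<C>. 4 * card (M p)) \<le> (\<Sum>p\<in>\<C> \<times> \<C>. T\<^sup>2)"
      by (rule sum_mono) (rule M)
    also have "\<dots> = (card \<C> * T)\<^sup>2"
      by (simp add: card_cartesian_product power2_eq_square)
    also have "card \<C> * T = card (\<Union>\<C>)"
      using C(2,4) fin by (simp add: card_Union_disjoint)
    also have "card (\<Union>\<C>) \<le> n" using card_mono[OF _ C(1)] by simp
    finally have "4 * card E \<le> 8 * (r * n) + n\<^sup>2" by simp
    moreover have "2 * ((n choose 2) div 2) \<le> card E"
      using two_card_colour_class[of n \<alpha> c'] half[of c'] unfolding E_def by linarith
    moreover have "2 * (n choose 2) + n = n\<^sup>2"
      using n by (cases n) (simp_all add: two_choose_two power2_eq_square)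
    \<comment> \<open>Up to rounding, \<open>c'\<close> has half of the edges, about
      \<open>n\<^sup>2 / 2\<close> ordered pairs, against at most
      \<open>n\<^sup>2 / 4 + 2 * r * n\<close>; the choice \<open>n \<ge> 8 * r + 8\<close> makes
      these incompatible.\<close>
    ultimately have "n\<^sup>2 \<le> 8 * (r * n) + 2 * n + 4" by linarith
    moreover have "(8 * r + 8) * n \<le> n\<^sup>2" using n by (simp add: power2_eq_square)
    ultimately show False using n by (simp add: algebra_simps)
  qed
  thus ?thesis by blast
qed

section \<open>Half cuts and half induced subgraphs\<close>

lemma half_edges_colour:
  assumes "simple_graph G" "half_edges G {e \<in> edges G. \<beta> e = c}"
  shows "half_edges G {e \<in> edges G. \<beta> e = Red}"
proof (cases "c = Red")
  case False
  hence "{e \<in> edges G. \<beta> e = c} = edges G - {e \<in> edges G. \<beta> e = Red}"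
    by (auto simp: not_Red_iff)
  thus ?thesis using assms half_edges_Diff[OF finite_edges[OF assms(1)]] by auto
qed (use assms in simp)

lemma balanceableI:
  assumes G: "simple_graph G"
    and cut: "half_edges G (cut_edges G U)" and inner: "half_edges G (inner_edges G W)"
  shows "balanceable G"
proof -
  \<comment> \<open>Each side of the pattern has room for all of \<open>G\<close>; the successor
    makes \<open>t\<close> positive.\<close>
  define t where "t = Suc (card (verts G))"
  obtain n0 where n0: "\<And>n \<alpha>. n \<ge> n0 \<Longrightarrow> (\<And>c. (n choose 2) div 2 \<le> card (colour_class n \<alpha> c))
      \<Longrightarrow> unavoidable n t \<alpha>"
    using unavoidable_pattern[of t] by (auto simp: t_def)
  have fV: "finite (verts G)" using G by (simp add: simple_graph_def)
  have copy: "contains_balanced_copy n \<alpha> G" if unav: "unavoidable n t \<alpha>" for n \<alpha>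
  proof -
    obtain c d A B where A: "A \<subseteq> {..<n}" "card A = t" "unicoloured \<alpha> c A"
      and B: "B \<subseteq> {..<n}" "card B = t" "unicoloured \<alpha> d B"
      and AB: "A \<inter> B = {}" "\<forall>a\<in>A. \<forall>b\<in>B. \<alpha> {a, b} \<noteq> c"
      using unav unfolding unavoidable_def by blast
    have fin: "finite A" "finite B" using A(1) B(1) finite_subset by auto
    obtain g where g: "inj_on g (verts G)" "g ` verts G \<subseteq> A"
      using card_le_inj[OF fV fin(1)] A(2) by (auto simp: t_def)
    obtain h where h: "inj_on h (verts G)" "h ` verts G \<subseteq> B"
      using card_le_inj[OF fV fin(2)] B(2) by (auto simp: t_def)
    \<comment> \<open>If both cliques have the same colour, the other colour appears exactly on the
      cut of \<open>X\<close>; otherwise colour \<open>c\<close> appears exactly inside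
      \<open>X\<close>.\<close>
    define X where "X = (if c = d then U else W)"
    define f where "f v = (if v \<in> X then g v else h v)" for v
    have fX: "f v \<in> A \<longleftrightarrow> v \<in> X" "f v \<in> B \<longleftrightarrow> v \<notin> X" if "v \<in> verts G" for v
      using that g(2) h(2) AB(1) by (auto simp: f_def)
    have inj: "inj_on f (verts G)"
    proof (rule inj_onI)
      fix u v assume uv: "u \<in> verts G" "v \<in> verts G" "f u = f v"
      hence "u \<in> X \<longleftrightarrow> v \<in> X" using fX by metis
      thus "u = v" using uv g(1) h(1) by (auto simp: f_def inj_on_eq_iff split: if_splits)
    qed
    have "f v \<in> A \<or> f v \<in> B" if "v \<in> verts G" for v using fX[OF that] by blast
    hence im: "f ` verts G \<subseteq> {..<n}" using A(1) B(1) by blast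
    have col: "\<alpha> (f ` e) = c \<longleftrightarrow> e \<subseteq> X \<or> e \<inter> X = {} \<and> c = d" if e: "e \<in> edges G" for e
    proof -
      obtain u v where uv: "e = {u, v}" "u \<noteq> v" "u \<in> verts G" "v \<in> verts G"
        using edge_cases[OF G e] .
      have ne: "f u \<noteq> f v" using uv inj by (meson inj_onD)
      consider "u \<in> X" "v \<in> X" | "u \<in> X" "v \<notin> X" | "u \<notin> X" "v \<in> X" | "u \<notin> X" "v \<notin> X" by blast
      thus ?thesis
      proof cases
        case 1
        hence "\<alpha> {f u, f v} = c" using A(3) fX uv ne unfolding unicoloured_def by blast
        thus ?thesis using 1 uv by auto
      next
        case 2
        hence "\<alpha> {f u, f v} \<noteq> c" using AB(2) fX uv by blast
        thus ?thesis using 2 uv by auto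
      next
        case 3
        hence "\<alpha> {f v, f u} \<noteq> c" using AB(2) fX uv by blast
        thus ?thesis using 3 uv by (auto simp: insert_commute)
      next
        case 4
        hence "\<alpha> {f u, f v} = d" using B(3) fX uv ne unfolding unicoloured_def by blast
        thus ?thesis using 4 uv by auto
      qed
    qed
    have "half_edges G {e \<in> edges G. \<alpha> (f ` e) = c}"
    proof (cases "c = d")
      case True
      hence "{e \<in> edges G. \<alpha> (f ` e) = c} = edges G - cut_edges G U"
        using col by (auto simp: cut_edges_def X_def)
      thus ?thesis using cut half_edges_Diff[OF finite_edges[OF G]] by (simp add: cut_edges_def)
    next
      case False
      hence "{e \<in> edges G. \<alpha> (f ` e) = c} = inner_edges G W"
        using col by (auto simp: inner_edges_def X_def)
      thus ?thesis using inner by simp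
    qed
    from half_edges_colour[OF G this] show ?thesis
      using inj im by (auto simp: contains_balanced_copy_iff[OF G])
  qed
  show ?thesis unfolding balanceable_def
  \<comment> \<open>For \<open>n \<ge> 3\<close> half of the edges, rounded down, is at least 1, so
    subtracting 1 gives an \<open>m\<close> strictly below it.\<close>
  proof (rule exI[of _ "n0 + 3"], intro allI impI)
    fix n assume n: "n0 + 3 \<le> n"
    have "3 * 2 \<le> n * (n - 1)" using n by (intro mult_le_mono) auto
    hence C: "0 < (n choose 2) div 2" using two_choose_two[of n] by linarith
    show "\<exists>m<(n choose 2) div 2. \<forall>\<alpha>. m < card (colour_class n \<alpha> Red) \<and> m < card (colour_class n \<alpha> Blue) \<longrightarrow>
      contains_balanced_copy n \<alpha> G"
    proof (rule exI[of _ "(n choose 2) div 2 - 1"], intro conjI allI impI)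
      show "(n choose 2) div 2 - 1 < (n choose 2) div 2" using C by simp
    next
      fix \<alpha> assume m: "(n choose 2) div 2 - 1 < card (colour_class n \<alpha> Red) \<and>
        (n choose 2) div 2 - 1 < card (colour_class n \<alpha> Blue)"
      have "(n choose 2) div 2 \<le> card (colour_class n \<alpha> c)" for c
        using m by (cases c) auto
      thus "contains_balanced_copy n \<alpha> G" using n by (intro copy n0) auto
    qed
  qed
qed

section \<open>Necessary conditions from colourings with two equal classes\<close>

text \<open>A colouring with exactly half of the edges red exceeds every admissible \<open>m\<close>
  in both colours, so it contains a balanced copy. \<open>Q\<close> records the shape of the
  colouring.\<close>

lemma balanceableD:
  assumes G: "simple_graph G" and bal: "balanceable G"
    and ex: "\<And>n0. \<exists>n\<ge>n0. \<exists>\<alpha>. Q \<alpha> \<and> 2 * card (colour_class n \<alpha> Red) = n choose 2"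
  shows "\<exists>\<alpha> f. Q \<alpha> \<and> half_edges G {e \<in> edges G. \<alpha> (f ` e) = Red}"
proof -
  obtain n0 where n0: "\<And>n. n \<ge> n0 \<Longrightarrow> \<exists>m<(n choose 2) div 2.
      \<forall>\<alpha>. m < card (colour_class n \<alpha> Red) \<and> m < card (colour_class n \<alpha> Blue) \<longrightarrow>
      contains_balanced_copy n \<alpha> G"
    using bal unfolding balanceable_def by blast
  obtain n \<alpha> where n: "n \<ge> n0" "Q \<alpha>" "2 * card (colour_class n \<alpha> Red) = n choose 2"
    using ex by blast
  have fin: "finite (edges (complete_graph n))"
    by (rule finite_edges[OF simple_graph_complete_graph])
  have "colour_class n \<alpha> Blue = edges (complete_graph n) - colour_class n \<alpha> Red"
    by (auto simp: colour_class_def simp flip: not_Red_iff)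
  hence "card (colour_class n \<alpha> Blue) = (n choose 2) - card (colour_class n \<alpha> Red)"
    using fin by (simp add: card_Diff_subset colour_class_def card_edges_complete_graph)
  hence "card (colour_class n \<alpha> Blue) = (n choose 2) div 2" "card (colour_class n \<alpha> Red) = (n choose 2) div 2"
    using n(3) by linarith+
  hence "contains_balanced_copy n \<alpha> G" using n0[OF n(1)] by auto
  thus ?thesis using n(2) by (auto simp: contains_balanced_copy_iff[OF G])
qed

lemma balanceable_half_cut:
  assumes G: "simple_graph G" and bal: "balanceable G"
  shows "\<exists>W. half_edges G (cut_edges G W)"
proof -
  define cutcol where "cutcol a e = (if e \<inter> {..<a} \<noteq> {} \<and> \<not> e \<subseteq> {..<a} then Red else Blue)"
    for a :: nat and e
  have "\<exists>n\<ge>n0. \<exists>\<alpha>. (\<exists>a. \<alpha> = cutcol a) \<and> 2 * card (colour_class n \<alpha> Red) = n choose 2" for n0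
  proof -
    \<comment> \<open>The sides of the cut are consecutive triangular numbers with sum the square
      \<open>n\<close>; their product is \<open>n * (n - 1) / 4\<close>.\<close>
    define a where "a = n0 * Suc n0 div 2"
    define n where "n = (Suc n0)\<^sup>2"
    have a2: "2 * a = n0 * Suc n0" by (simp add: a_def)
    have n: "n = 2 * a + Suc n0" unfolding a2 n_def by (simp add: power2_eq_square)
    let ?P = "{..<a} \<times> {a..<n}"
    have "colour_class n (cutcol a) Red = (\<lambda>(x, y). {x, y}) ` ?P" (is "?L = ?R")
    proof
      show "?R \<subseteq> ?L" using n by (auto simp: colour_class_def complete_graph_def cutcol_def nsets_def)
      show "?L \<subseteq> ?R"
      proof
        fix e assume "e \<in> ?L"
        then obtain x y where "e = {x, y}" "x < a" "\<not> y < a" "y < n"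
          unfolding colour_class_def complete_graph_def cutcol_def
          by (auto simp: nsets_2_eq insert_commute split: if_splits)
        thus "e \<in> ?R" by (intro image_eqI[of _ _ "(x, y)"]) auto
      qed
    qed
    moreover have "inj_on (\<lambda>(x, y). {x, y}) ?P"
      by (auto simp: inj_on_def doubleton_eq_iff)
    ultimately have "card (colour_class n (cutcol a) Red) = a * (n - a)"
      by (simp add: card_image card_cartesian_product)
    also have "n - a = a + Suc n0" using n by simp
    finally have c: "4 * card (colour_class n (cutcol a) Red) = (2 * a) * (2 * a + 2 * Suc n0)" by simp
    have "n * (n - 1) = (2 * a) * (2 * a + 2 * Suc n0)"
      unfolding a2 n_def by (simp add: power2_eq_square algebra_simps)
    hence "2 * card (colour_class n (cutcol a) Red) = n choose 2" using c two_choose_two[of n] by linarith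
    moreover have "n0 \<le> n" using n by simp
    ultimately show ?thesis by blast
  qed
  from balanceableD[OF G bal this] obtain a f
    where half: "half_edges G {e \<in> edges G. cutcol a (f ` e) = Red}" by blast
  have "{e \<in> edges G. cutcol a (f ` e) = Red} = cut_edges G {v. f v < a}"
    by (auto simp: cutcol_def cut_edges_def)
  thus ?thesis using half by metis
qed

text \<open>The recursion steps from one solution of the Pell equation
  $(2n-1)^2 - 2(2b-1)^2 = -1$ to the next, written in terms of $n - 1$ and $b - 1$.\<close>

lemma half_choose_two_solutions: "\<exists>n\<ge>n0. \<exists>b\<le>n. 2 * (b choose 2) = n choose 2"
proof -
  have "\<exists>n b. n \<ge> n0 \<and> b \<le> n \<and> 2 * (Suc b * b) = Suc n * n"
  proof (induction n0)
    case 0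
    show ?case by (intro exI[of _ 0]) auto
  next
    case (Suc n0)
    then obtain n b where "n \<ge> n0" "b \<le> n" "2 * (Suc b * b) = Suc n * n" by blast
    thus ?case
      by (intro exI[of _ "3 * n + 4 * b + 3"] exI[of _ "2 * n + 3 * b + 2"]) (auto simp: algebra_simps)
  qed
  then obtain n b where nb: "n \<ge> n0" "b \<le> n" "2 * (Suc b * b) = Suc n * n" by blast
  have "2 * (2 * (Suc b choose 2)) = 2 * (Suc n choose 2)"
    unfolding two_choose_two using nb(3) by simp
  thus ?thesis using nb(1,2) by (intro exI[of _ "Suc n"] conjI exI[of _ "Suc b"]) auto
qed

lemma balanceable_half_inner:
  assumes G: "simple_graph G" and bal: "balanceable G"
  shows "\<exists>W. half_edges G (inner_edges G W)"
proof -
  define cliquecol where "cliquecol b e = (if e \<subseteq> {..<b} then Red else Blue)" for b :: nat and e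
  have "\<exists>n\<ge>n0. \<exists>\<alpha>. (\<exists>b. \<alpha> = cliquecol b) \<and> 2 * card (colour_class n \<alpha> Red) = n choose 2" for n0
  proof -
    obtain n b where nb: "n \<ge> n0" "b \<le> n" "2 * (b choose 2) = n choose 2"
      using half_choose_two_solutions by blast
    have "colour_class n (cliquecol b) Red = [{..<b}]\<^bsup>2\<^esup>"
      using nsets_mono[of "{..<b}" "{..<n}" 2] nb(2)
      by (auto simp: colour_class_def complete_graph_def cliquecol_def nsets_def split: if_splits)
    hence "2 * card (colour_class n (cliquecol b) Red) = n choose 2" using nb(3) by simp
    thus ?thesis using nb(1) by blast
  qed
  from balanceableD[OF G bal this] obtain b f
    where half: "half_edges G {e \<in> edges G. cliquecol b (f ` e) = Red}" by blast
  have "{e \<in> edges G. cliquecol b (f ` e) = Red} = inner_edges G {v. f v < b}"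
    by (auto simp: cliquecol_def inner_edges_def)
  thus ?thesis using half by metis
qed

section \<open>Counting edges of chorded cycles\<close>

text \<open>\<open>C\<^sub>k\<^sub>,\<^sub>l\<close> is described without modular arithmetic: \<open>{i, j}\<close> with \<open>i < j < k\<close> is an edge iff
  \<open>j - i\<close> is an offset.  When \<open>k = 2 l\<close>, two of the four offsets coincide.\<close>

definition offsets :: "nat \<Rightarrow> nat \<Rightarrow> nat set" where
  "offsets k l = {1, k - 1, l, k - l}"

text \<open>Edges are written from their smaller end: the difference is \<open>s\<close> without
  wraparound and \<open>k - s\<close> with it.\<close>

lemma shift_edges:
  fixes k s :: nat
  assumes "0 < s" "s < k"
  shows "(\<lambda>i. {i, (i + s) mod k}) ` {..<k} = {{i, i + d} |i d. d \<in> {s, k - s} \<and> i + d < k}" (is "?L = ?R")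
proof
  show "?L \<subseteq> ?R"
  proof
    fix e assume "e \<in> ?L"
    then obtain i where i: "i < k" "e = {i, (i + s) mod k}" by blast
    show "e \<in> ?R"
    proof (cases "i + s < k")
      case True
      hence "e = {i, i + s}" "i + s < k" using i by auto
      thus ?thesis by blast
    next
      case False
      hence "(i + s) mod k = i + s - k" using i assms by (simp add: mod_if)
      moreover have "i = i + s - k + (k - s)" using False assms by simp
      ultimately have "e = {i + s - k, i + s - k + (k - s)}" "i + s - k + (k - s) < k" using i by auto
      thus ?thesis by blast
    qed
  qed
  show "?R \<subseteq> ?L"
  proof
    fix e assume "e \<in> ?R"
    then obtain i d where d: "d = s \<or> d = k - s" "i + d < k" "e = {i, i + d}" by auto
    show "e \<in> ?L"
    proof (cases "d = s")
      case True
      thus ?thesis using d by (intro image_eqI[of _ _ i]) auto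
    next
      case False
      hence "i + d + s = i + k" using d(1) assms by auto
      hence "(i + d + s) mod k = (i + k) mod k" by (simp only:)
      also have "\<dots> = i" using d(2) by simp
      finally have "(i + d + s) mod k = i" .
      thus ?thesis using d by (intro image_eqI[of _ _ "i + d"]) auto
    qed
  qed
qed

lemma edges_chorded_cycle:
  assumes "l \<in> {2..k - 2}"
  shows "edges (chorded_cycle k l) = {{i, i + d} |i d. d \<in> offsets k l \<and> i + d < k}"
proof -
  have "0 < l" "l < k" "1 < k" using assms by auto
  hence "edges (chorded_cycle k l) =
      {{i, i + d} |i d. d \<in> {1, k - 1} \<and> i + d < k} \<union> {{i, i + d} |i d. d \<in> {l, k - l} \<and> i + d < k}"
    using shift_edges[of 1 k] shift_edges[of l k] unfolding chorded_cycle_def by simp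
  thus ?thesis unfolding offsets_def by blast
qed

lemma chorded_cycle_symmetric:
  assumes "l \<in> {2..k - 2}"
  shows "chorded_cycle k (k - l) = chorded_cycle k l"
proof -
  have "offsets k (k - l) = offsets k l" using assms by (auto simp: offsets_def)
  hence "edges (chorded_cycle k (k - l)) = edges (chorded_cycle k l)"
    using edges_chorded_cycle[of l k] edges_chorded_cycle[of "k - l" k] assms by fastforce
  thus ?thesis by (simp add: chorded_cycle_def)
qed

text \<open>An edge determines its smaller end and its positive difference, and
  \<open>offsets k l\<close> is a set, so no edge is counted twice, even for
  \<open>k = 2 * l\<close>.\<close>

lemma sum_edges_chorded_cycle:
  fixes g :: "nat set \<Rightarrow> nat"
  assumes l: "l \<in> {2..k - 2}"
  shows "sum g (edges (chorded_cycle k l)) = (\<Sum>d\<in>offsets k l. \<Sum>i<k - d. g {i, i + d})"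
proof -
  let ?S = "Sigma (offsets k l) (\<lambda>d. {..<k - d})"
  have pos: "0 < d" if "d \<in> offsets k l" for d using that l by (auto simp: offsets_def)
  have "inj_on (\<lambda>(d, i). {i, i + d}) ?S"
    using pos by (fastforce simp: inj_on_def doubleton_eq_iff)
  moreover have "edges (chorded_cycle k l) = (\<lambda>(d, i). {i, i + d}) ` ?S"
    unfolding edges_chorded_cycle[OF l] by (force simp: less_diff_conv)
  ultimately have "sum g (edges (chorded_cycle k l)) = (\<Sum>(d, i)\<in>?S. g {i, i + d})"
    by (simp add: sum.reindex case_prod_unfold)
  also have "\<dots> = (\<Sum>d\<in>offsets k l. \<Sum>i<k - d. g {i, i + d})"
    by (rule sum.Sigma[symmetric]) (auto simp: offsets_def)
  finally show ?thesis .
qed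

lemma sum_offsets:
  fixes h :: "nat \<Rightarrow> nat"
  assumes "l \<in> {2..k - 2}"
  shows "sum h (offsets k l) = h 1 + h (k - 1) + h l + (if 2 * l = k then 0 else h (k - l))"
proof -
  have d: "1 \<noteq> k - 1" "1 \<noteq> l" "1 \<noteq> k - l" "k - 1 \<noteq> l" "k - 1 \<noteq> k - l" "l = k - l \<longleftrightarrow> 2 * l = k"
    using assms by auto
  show ?thesis
  proof (cases "2 * l = k")
    case True
    hence "offsets k l = {1, k - 1, l}" using d by (auto simp: offsets_def)
    thus ?thesis using True d by simp
  next
    case False
    thus ?thesis unfolding offsets_def using d by simp
  qed
qed

lemma card_edges_chorded_cycle:
  assumes "l \<in> {2..k - 2}"
  shows "card (edges (chorded_cycle k l)) = (if 2 * l = k then 3 * l else 2 * k)"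
  using sum_edges_chorded_cycle[OF assms, of "\<lambda>_. 1"] assms by (auto simp: sum_offsets)

text \<open>An edge has one end in \<open>W\<close> if it is cut and two if it lies inside; the left
  side is the degree sum over \<open>W\<close>.\<close>

lemma handshake:
  assumes G: "simple_graph G"
  shows "(\<Sum>e\<in>edges G. card (e \<inter> W)) = card (cut_edges G W) + 2 * card (inner_edges G W)"
proof -
  note fE = finite_edges[OF G]
  have "(\<Sum>e\<in>edges G. card (e \<inter> W)) =
    (\<Sum>e\<in>edges G. of_bool (e \<in> cut_edges G W) + 2 * of_bool (e \<in> inner_edges G W))"
  proof (rule sum.cong)
    fix e assume e: "e \<in> edges G"
    then obtain u v where uv: "e = {u, v}" "u \<noteq> v" using edge_cases[OF G e] by metis
    show "card (e \<inter> W) = of_bool (e \<in> cut_edges G W) + 2 * of_bool (e \<in> inner_edges G W)"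
      using e uv(2) unfolding cut_edges_def inner_edges_def uv(1)
      by (cases "u \<in> W"; cases "v \<in> W") auto
  qed simp
  also have "\<dots> = card (edges G \<inter> cut_edges G W) + 2 * card (edges G \<inter> inner_edges G W)"
    using fE by (simp add: sum.distrib of_bool_def sum.If_cases flip: sum_distrib_left)
  also have "edges G \<inter> cut_edges G W = cut_edges G W" by (auto simp: cut_edges_def)
  also have "edges G \<inter> inner_edges G W = inner_edges G W" by (auto simp: inner_edges_def)
  finally show ?thesis .
qed

lemma card_edges_split:
  assumes G: "simple_graph G"
  shows "card (edges G) = card (cut_edges G W) + card (inner_edges G W) + card (inner_edges G (verts G - W))"
proof -
  have "edges G = cut_edges G W \<union> inner_edges G W \<union> inner_edges G (verts G - W)"
    using edges_subset_Pow[OF G] by (auto simp: cut_edges_def inner_edges_def)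
  moreover have "cut_edges G W \<inter> inner_edges G W = {}"
    by (auto simp: cut_edges_def inner_edges_def)
  moreover have "e \<noteq> {}" if "e \<in> edges G" for e using edge_cases[OF G that] by auto
  hence "(cut_edges G W \<union> inner_edges G W) \<inter> inner_edges G (verts G - W) = {}"
    by (fastforce simp: cut_edges_def inner_edges_def)
  moreover have "finite (cut_edges G W)" "finite (inner_edges G W)" "finite (inner_edges G (verts G - W))"
    using finite_edges[OF G] by (auto simp: cut_edges_def inner_edges_def)
  ultimately show ?thesis by (metis card_Un_disjoint finite_Un)
qed

text \<open>Vertices below \<open>k - d\<close> are the lower ends for offset \<open>d\<close>; the
  others are the upper ends for offset \<open>k - d\<close>.\<close>

lemma degree_sum_pair:
  fixes k d :: nat
  assumes "W \<subseteq> {..<k}" "d \<le> k"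
  shows "(\<Sum>i<k - d. of_bool (i \<in> W)) + (\<Sum>i<d. of_bool (i + (k - d) \<in> W)) = (card W :: nat)"
proof -
  have "(\<Sum>i<d. of_bool (i + (k - d) \<in> W)) = (\<Sum>i\<in>{k - d..<k}. of_bool (i \<in> W) :: nat)"
    by (rule sum.reindex_bij_witness[of _ "\<lambda>i. i - (k - d)" "\<lambda>i. i + (k - d)"]) (use assms(2) in auto)
  hence "(\<Sum>i<k - d. of_bool (i \<in> W)) + (\<Sum>i<d. of_bool (i + (k - d) \<in> W)) = (\<Sum>i<k. of_bool (i \<in> W) :: nat)"
    using sum.atLeastLessThan_concat[of 0 "k - d" k "\<lambda>i. of_bool (i \<in> W) :: nat"] assms(2)
    unfolding lessThan_atLeast0 by linarith
  also have "\<dots> = card ({..<k} \<inter> W)" by (simp add: of_bool_def sum.If_cases)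
  also have "{..<k} \<inter> W = W" using assms(1) by auto
  finally show ?thesis .
qed

lemma degree_sum_chorded_cycle:
  assumes l: "l \<in> {2..k - 2}" and W: "W \<subseteq> {..<k}"
  shows "(\<Sum>e\<in>edges (chorded_cycle k l). card (e \<inter> W)) = (if 2 * l = k then 3 else 4) * card W"
proof -
  define h :: "nat \<Rightarrow> nat"
    where "h d = (\<Sum>i<k - d. of_bool (i \<in> W)) + (\<Sum>i<k - d. of_bool (i + d \<in> W))" for d
  have "(\<Sum>e\<in>edges (chorded_cycle k l). card (e \<inter> W)) = (\<Sum>d\<in>offsets k l. h d)"
    unfolding sum_edges_chorded_cycle[OF l] h_def sum.distrib[symmetric]
  proof (intro sum.cong refl)
    fix d i assume "d \<in> offsets k l" "i \<in> {..<k - d}"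
    hence "d > 0" using l by (auto simp: offsets_def)
    thus "card ({i, i + d} \<inter> W) = of_bool (i \<in> W) + of_bool (i + d \<in> W)"
      by (cases "i \<in> W"; cases "i + d \<in> W") auto
  qed
  \<comment> \<open>Offsets \<open>d\<close> and \<open>k - d\<close> together contribute 2 to each
    degree; for \<open>k = 2 * l\<close> the offset \<open>l\<close> stands alone and contributes
    1.\<close>
  moreover have pair: "h d + h (k - d) = 2 * card W" if "d \<le> k" for d
    using degree_sum_pair[OF W that] degree_sum_pair[OF W, of "k - d"] that by (simp add: h_def)
  have "1 \<le> k" "l \<le> k" using l by auto
  note pair[OF this(1)] pair[OF this(2)]
  moreover have "2 * l = k \<Longrightarrow> h (k - l) = h l" by auto
  ultimately show ?thesis unfolding sum_offsets[OF l] by auto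
qed

text \<open>Sums are not reduced modulo \<open>k\<close>; wraparound is accounted for by the offsets
  \<open>k - 1\<close> and \<open>k - l\<close>.\<close>

definition gap_count :: "nat set \<Rightarrow> nat \<Rightarrow> nat" where
  "gap_count U d = card {i \<in> U. i + d \<in> U}"

lemma card_inner_edges_chorded_cycle:
  assumes l: "l \<in> {2..k - 2}"
  shows "card (inner_edges (chorded_cycle k l) U) = 
    (\<Sum>d\<in>offsets k l. \<Sum>i<k - d. of_bool (i \<in> U \<and> i + d \<in> U))"
proof -
  have "finite (edges (chorded_cycle k l))" by (simp add: chorded_cycle_def)
  hence "card (inner_edges (chorded_cycle k l) U) = (\<Sum>e\<in>edges (chorded_cycle k l). of_bool (e \<subseteq> U))"
    unfolding inner_edges_def by (simp add: of_bool_def sum.If_cases Int_def)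
  thus ?thesis unfolding sum_edges_chorded_cycle[OF l] by simp
qed

lemma card_inner_edges_gap_count:
  assumes l: "l \<in> {2..k - 2}" and U: "U \<subseteq> {..<k}"
  shows "card (inner_edges (chorded_cycle k l) U) = sum (gap_count U) (offsets k l)"
  unfolding card_inner_edges_chorded_cycle[OF l]
proof (rule sum.cong)
  fix d assume "d \<in> offsets k l"
  have "(\<Sum>i<k - d. of_bool (i \<in> U \<and> i + d \<in> U)) = card ({..<k - d} \<inter> {i. i \<in> U \<and> i + d \<in> U})"
    by (simp add: of_bool_def sum.If_cases)
  also have "{..<k - d} \<inter> {i. i \<in> U \<and> i + d \<in> U} = {i \<in> U. i + d \<in> U}" using U by auto
  finally show "(\<Sum>i<k - d. of_bool (i \<in> U \<and> i + d \<in> U)) = gap_count U d" by (simp add: gap_count_def)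
qed simp

text \<open>By the degree sum, \<open>U\<close> cuts \<open>4 * card U - 2 * N\<close> of the
  \<open>2 * k\<close> edges, and parity turns the tolerance 1 into an equality. For
  \<open>2 * l = k\<close> it cuts \<open>3 * card U - 2 * N\<close> of \<open>3 * l\<close> edges
  and the tolerance remains.\<close>

lemma half_cut_chorded_cycleI:
  assumes l: "l \<in> {2..k - 2}" "k > 3" and U: "U \<subseteq> {..<k}"
    and N: "sum (gap_count U) (offsets k l) = N"
    and eq: "if 2 * l = k then \<bar>2 * (3 * int (card U) - 2 * int N) - 3 * int l\<bar> \<le> 1
             else 4 * card U = k + 2 * N"
  shows "half_edges (chorded_cycle k l) (cut_edges (chorded_cycle k l) U)"
  using handshake[OF simple_graph_chorded_cycle[OF l(2,1)], of U] degree_sum_chorded_cycle[OF l(1) U]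
    card_inner_edges_gap_count[OF l(1) U] card_edges_chorded_cycle[OF l(1)] eq
  unfolding N
  unfolding half_edges_def by (simp split: if_splits)

text \<open>The set that induces half of the edges is the complement of \<open>U\<close>.\<close>

lemma half_inner_chorded_cycleI:
  assumes l: "l \<in> {2..k - 2}" "k > 3" and U: "U \<subseteq> {..<k}"
    and N: "sum (gap_count U) (offsets k l) = N"
    and eq: "if 2 * l = k then \<bar>2 * (3 * int l - 3 * int (card U) + int N) - 3 * int l\<bar> \<le> 1
             else 4 * card U = k + N"
  shows "\<exists>W. half_edges (chorded_cycle k l) (inner_edges (chorded_cycle k l) W)"
  using handshake[OF simple_graph_chorded_cycle[OF l(2,1)], of U] degree_sum_chorded_cycle[OF l(1) U]
    card_edges_split[OF simple_graph_chorded_cycle[OF l(2,1)], of U]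
    card_inner_edges_gap_count[OF l(1) U] card_edges_chorded_cycle[OF l(1)] eq
  unfolding N
  unfolding half_edges_def
  by (intro exI[of _ "verts (chorded_cycle k l) - U"]) (simp split: if_splits)

lemma gap_count_lessThan: "gap_count {..<m} d = m - d"
proof -
  have "{i \<in> {..<m}. i + d \<in> {..<m}} = {..<m - d}" by auto
  thus ?thesis by (simp add: gap_count_def)
qed

text \<open>As \<open>p\<close> lies above all of \<open>U\<close>, the only possible new pair is
  \<open>p - d\<close>, \<open>p\<close>. Sets can thus be built upwards vertex by vertex.\<close>

lemma gap_count_insert:
  assumes "\<And>u. u \<in> U \<Longrightarrow> u < p" "0 < d"
  shows "gap_count (insert p U) d = gap_count U d + of_bool (d \<le> p \<and> p - d \<in> U)"
proof -
  have "finite U" using assms(1) by (meson finite_nat_iff_bounded lessThan_iff subsetI)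
  have "p + d \<notin> insert p U" using assms(1)[of "p + d"] assms(2) by auto
  hence "{i \<in> insert p U. i + d \<in> insert p U} = {i \<in> U. i + d \<in> U} \<union> {i \<in> U. i + d = p}" by auto
  moreover have "{i \<in> U. i + d = p} = (if d \<le> p \<and> p - d \<in> U then {p - d} else {})" by auto
  moreover have "{i \<in> U. i + d \<in> U} \<inter> {i \<in> U. i + d = p} = {}" using assms(1) by fastforce
  ultimately show ?thesis using \<open>finite U\<close> by (simp add: gap_count_def card_Un_disjoint)
qed

definition evens_below :: "nat \<Rightarrow> nat set" where
  "evens_below q = (*) 2 ` {..<q}"

lemma card_evens_below: "card (evens_below q) = q"
  by (simp add: evens_below_def card_image inj_on_def)

lemma finite_evens_below: "finite (evens_below q)"
  by (simp add: evens_below_def)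

lemma mem_evens_below: "i \<in> evens_below q \<longleftrightarrow> even i \<and> i < 2 * q"
  by (auto simp: evens_below_def elim!: evenE)

lemma gap_count_evens_below: "gap_count (evens_below q) d = (if even d then q - d div 2 else 0)"
proof -
  have "{i \<in> evens_below q. i + d \<in> evens_below q} = (if even d then evens_below (q - d div 2) else {})"
    by (auto simp: mem_evens_below elim!: evenE)
  thus ?thesis by (simp add: gap_count_def card_evens_below)
qed

section \<open>Balanceable chorded cycles\<close>

lemma gap_count_sum_less:
  assumes "l \<in> {2..k - 2}" "2 * l < k"
  shows "sum (gap_count U) (offsets k l) =
    gap_count U 1 + gap_count U (k - 1) + gap_count U l + gap_count U (k - l)"
  using assms by (simp add: sum_offsets)

section \<open>Obstructions: odd \<open>k\<close> and the octahedron\<close>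

lemma not_balanceable_odd:
  assumes l: "l \<in> {2..k - 2}" and k: "k > 3" "odd k"
  shows "\<not> balanceable (chorded_cycle k l)"
proof
  note G = simple_graph_chorded_cycle[OF k(1) l]
  assume "balanceable (chorded_cycle k l)"
  then obtain W where W: "half_edges (chorded_cycle k l) (cut_edges (chorded_cycle k l) W)"
    using balanceable_half_cut[OF G] by blast
  have "2 * l \<noteq> k" using k(2) by auto
  have V: "verts (chorded_cycle k l) = {..<k}" by (simp add: chorded_cycle_def)
  \<comment> \<open>\<open>W\<close> may contain numbers that are not vertices, while the degree sum
    needs a subset of \<open>{..<k}\<close>.\<close>
  have "cut_edges (chorded_cycle k l) W = cut_edges (chorded_cycle k l) (W \<inter> {..<k})"
    using edges_subset_Pow[OF G] unfolding cut_edges_def V by blast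
  hence "card (cut_edges (chorded_cycle k l) W)
      + 2 * card (inner_edges (chorded_cycle k l) (W \<inter> {..<k})) = 4 * card (W \<inter> {..<k})"
    using handshake[OF G, of "W \<inter> {..<k}"] degree_sum_chorded_cycle[OF l, of "W \<inter> {..<k}"]
      \<open>2 * l \<noteq> k\<close> by simp
  moreover have "card (cut_edges (chorded_cycle k l) W) = k"
    using W \<open>2 * l \<noteq> k\<close> unfolding half_edges_def card_edges_chorded_cycle[OF l] by simp
  ultimately show False using k(2) by presburger
qed

lemma not_balanceable_6_2: "\<not> balanceable (chorded_cycle 6 2)"
proof
  have l: "(2::nat) \<in> {2..6 - 2}" and k: "(6::nat) > 3" by auto
  assume "balanceable (chorded_cycle 6 2)"
  then obtain W where W: "half_edges (chorded_cycle 6 2) (inner_edges (chorded_cycle 6 2) W)"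
    using balanceable_half_inner[OF simple_graph_chorded_cycle[OF k l]] by blast
  hence "card (inner_edges (chorded_cycle 6 2) W) = 6"
    unfolding half_edges_def card_edges_chorded_cycle[OF l] by simp
  \<comment> \<open>Only the membership of the six vertices matters. Four vertices of the octahedron
    induce at most 5 edges and five induce 8, so 6 is skipped.\<close>
  thus False unfolding card_inner_edges_chorded_cycle[OF l] sum_offsets[OF l]
    by (cases "0 \<in> W"; cases "1 \<in> W"; cases "2 \<in> W"; cases "3 \<in> W"; cases "4 \<in> W"; cases "5 \<in> W")
      (simp_all add: numeral_eq_Suc)
qed

section \<open>Vertex sets for the balanceable cases\<close>

text \<open>For odd \<open>l\<close> all offsets are odd, so the even vertices are independent;
  keeping only those below \<open>k div 2\<close> also avoids the difference \<open>l\<close> when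
  \<open>k = 2 * l\<close>. If \<open>k div 2\<close> is odd, it is added as a vertex and creates
  one edge. The equation gives a half cut, and for \<open>2 * l = k\<close> also a complement
  inducing half of the edges.\<close>

lemma sparse_set_exists:
  assumes l: "l \<in> {2..k - 2}" and k: "2 * l \<le> k" "even k" and odd: "odd l \<or> 2 * l = k"
  shows "\<exists>U\<subseteq>{..<k}. \<exists>N\<le>1. sum (gap_count U) (offsets k l) = N \<and> 4 * card U = k + 2 * N"
proof -
  obtain j where j: "k = 2 * j" using k(2) by (elim evenE)
  have lj: "2 \<le> l" "l \<le> j" using l k(1) j by auto
  show ?thesis
  proof (cases "even j")
    case True
    then obtain q where q: "j = 2 * q" by (elim evenE)
    have "gap_count (evens_below q) d = 0" if "d \<in> offsets k l" for d
      using that odd j lj q by (auto simp: offsets_def gap_count_evens_below)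
    hence "sum (gap_count (evens_below q)) (offsets k l) = 0" by simp
    moreover have "evens_below q \<subseteq> {..<k}" using j q by (auto simp: mem_evens_below)
    ultimately show ?thesis
      by (intro exI[of _ "evens_below q"] conjI exI[of _ 0]) (auto simp: card_evens_below j q)
  next
    case False
    then obtain q where q: "j = 2 * q + 1" by (elim oddE)
    have "odd l" using odd j False by auto
    let ?U = "insert j (evens_below q)"
    have U: "?U \<subseteq> {..<k}" "j \<notin> evens_below q" using j q by (auto simp: mem_evens_below)
    have N: "gap_count ?U d = of_bool (d = l)" if "d \<in> offsets k l" for d
    proof -
      have d: "odd d" "0 < d" "d \<le> j \<longrightarrow> d = 1 \<or> d = l"
        using that \<open>odd l\<close> lj j l by (auto simp: offsets_def)
      have "gap_count ?U d = of_bool (d \<le> j \<and> j - d \<in> evens_below q)"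
        using d(1,2) q by (subst gap_count_insert) (auto simp: gap_count_evens_below mem_evens_below)
      \<comment> \<open>\<open>j - 1 = 2 * q\<close> just misses \<open>evens_below q\<close>, so
        \<open>j\<close> is joined only to \<open>j - l\<close>.\<close>
      also have "d \<le> j \<and> j - d \<in> evens_below q \<longleftrightarrow> d = l"
        using d \<open>odd l\<close> lj q by (auto simp: mem_evens_below)
      finally show ?thesis .
    qed
    have "sum (gap_count ?U) (offsets k l) = (\<Sum>d\<in>offsets k l. of_bool (d = l))"
      using N by (rule sum.cong[OF refl])
    also have "\<dots> = 1" by (simp add: offsets_def)
    finally have "sum (gap_count ?U) (offsets k l) = 1" .
    moreover have "4 * card ?U = k + 2 * 1"
      using U(2) j q by (simp add: card_evens_below finite_evens_below)
    ultimately show ?thesis using U(1)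
      by (intro exI[of _ ?U] conjI exI[of _ 1]) auto
  qed
qed

lemma exists_half_cut:
  assumes l: "l \<in> {2..k - 2}" and k: "2 * l \<le> k" "even k"
  shows "\<exists>W. half_edges (chorded_cycle k l) (cut_edges (chorded_cycle k l) W)"
proof (cases "odd l \<or> 2 * l = k")
  case True
  then obtain U N where U: "U \<subseteq> {..<k}" and N: "N \<le> 1" "sum (gap_count U) (offsets k l) = N" "4 * card U = k + 2 * N"
    using sparse_set_exists[OF l k] by blast
  show ?thesis
    by (rule exI[of _ U], rule half_cut_chorded_cycleI[OF l _ U N(2)]) (use l N in auto)
next
  case False
  obtain j where j: "k = 2 * j" using k(2) by (elim evenE)
  obtain a where a: "l = 2 * a" using False by (auto elim: evenE)
  \<comment> \<open>For even \<open>l\<close> all even vertices are taken: chords preserve parity,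
    so exactly the \<open>k\<close> edges of the cycle are cut.\<close>
  have U: "evens_below j \<subseteq> {..<k}" using j by (auto simp: mem_evens_below)
  have "2 * l < k" using False k(1) by simp
  hence N: "sum (gap_count (evens_below j)) (offsets k l) = j"
    unfolding gap_count_sum_less[OF l \<open>2 * l < k\<close>] using j a l
    by (simp add: gap_count_evens_below flip: right_diff_distrib')
  show ?thesis
    by (rule exI[of _ "evens_below j"], rule half_cut_chorded_cycleI[OF l _ U N])
      (use l j False in \<open>auto simp: card_evens_below\<close>)
qed

lemma exists_half_inner_eq:
  assumes l: "l \<in> {2..k - 2}" and k: "2 * l = k"
  shows "\<exists>W. half_edges (chorded_cycle k l) (inner_edges (chorded_cycle k l) W)"
proof -
  have "2 * l \<le> k" "even k" using k by auto
  then obtain U N where U: "U \<subseteq> {..<k}" and N: "N \<le> 1" "sum (gap_count U) (offsets k l) = N" "4 * card U = k + 2 * N"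
    using sparse_set_exists[OF l] k by blast
  show ?thesis
    by (rule half_inner_chorded_cycleI[OF l _ U N(2)]) (use l k N in auto)
qed

lemma gap_count_insert_lessThan:
  assumes "m \<le> p" "0 < d"
  shows "gap_count (insert p {..<m}) d = m - d + of_bool (d \<le> p \<and> p < m + d)"
proof -
  have "d \<le> p \<and> p - d \<in> {..<m} \<longleftrightarrow> d \<le> p \<and> p < m + d" using assms by auto
  thus ?thesis using gap_count_insert[of "{..<m}" p d] assms by (simp add: gap_count_lessThan)
qed

lemma exists_half_inner_less:
  assumes l: "l \<in> {2..k - 2}" and k: "2 * l < k" "even k" "(k, l) \<noteq> (6, 2)"
  shows "\<exists>W. half_edges (chorded_cycle k l) (inner_edges (chorded_cycle k l) W)"
proof -
  note [simp] = gap_count_lessThan gap_count_insert_lessThan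
  have k3: "k > 3" using l by auto
  have witness: ?thesis if "U \<subseteq> {..<k}" "gap_count U 1 = a" "gap_count U (k - 1) = 0"
    "gap_count U l = b" "gap_count U (k - l) = c" "4 * card U = k + a + b + c" for U a b c
    using half_inner_chorded_cycleI[OF l k3 that(1) gap_count_sum_less[OF l k(1)]] that k(1) by simp
  txt \<open>\<open>4 |U| - e\<close> edges meet a set \<open>U\<close> inducing \<open>e\<close> edges, and this has to equal \<open>k\<close>.  An interval
    of length \<open>m\<close> meets \<open>3 m + 1\<close> edges if \<open>m \<le> l\<close> and \<open>2 m + l + 1\<close> edges if \<open>l \<le> m \<le> k - l\<close>.  The
    extra vertices, chosen with 0, 1 or 2 neighbours in the interval, correct the residue.\<close>
  have "even l \<and> 3 * l + 4 \<le> k \<or> odd l \<and> 3 * l + 1 \<le> k \<or> k mod 3 = 1 \<and> k \<le> 3 * l + 1 \<or>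
      k mod 3 = 2 \<and> k \<le> 3 * l - 1 \<or> k = 3 * l + 2 \<or> k mod 3 = 0 \<and> k \<le> 3 * l - 3 \<or> k = 3 * l"
  proof (cases "k \<le> 3 * l + 2")
    case True
    moreover have "k mod 3 = 0 \<or> k mod 3 = 1 \<or> k mod 3 = 2" by linarith
    ultimately show ?thesis by presburger
  next
    case False
    \<comment> \<open>Since \<open>k\<close> is even, \<open>k = 3 * l + 3\<close> forces
      \<open>l\<close> to be odd; hence the even case may start at \<open>3 * l + 4\<close>.\<close>
    thus ?thesis using k(2) by (cases "k = 3 * l + 3") auto
  qed
  then consider (long_even) "even l" "3 * l + 4 \<le> k" | (long_odd) "odd l" "3 * l + 1 \<le> k"
    | (mod1) "k mod 3 = 1" "k \<le> 3 * l + 1"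
    | (mod2) "k mod 3 = 2" "k \<le> 3 * l - 1" | (mod2') "k = 3 * l + 2" 
    | (mod0) "k mod 3 = 0" "k \<le> 3 * l - 3" | (mod0') "k = 3 * l"
    by metis
  thus ?thesis
  proof cases
    case long_even
    have "even (k - l - 4)" using long_even k(2) by simp
    then obtain m where "k - l - 4 = 2 * m" by (elim evenE)
    hence m: "k = 2 * m + l + 4" "l \<le> m" using long_even by simp_all
    \<comment> \<open>Skipping \<open>m\<close> leaves \<open>m + 1\<close> with the single
      neighbour \<open>m + 1 - l\<close>, so it adds 3 to the \<open>2 * m + l + 1\<close> edges met
      by the interval.\<close>
    show ?thesis
      by (rule witness[of "insert (m + 1) {..<m}" "m - 1" "m + 1 - l" 0]) (use m l in simp_all)
  next
    case long_odd
    have "even (k - l - 1)" using long_odd k(2) by simp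
    then obtain m where "k - l - 1 = 2 * m" by (elim evenE)
    hence m: "k = 2 * m + l + 1" "l \<le> m" using long_odd by simp_all
    show ?thesis
      by (rule witness[of "{..<m}" "m - 1" "m - l" 0]) (use m l in simp_all)
  next
    case mod1
    define m where "m = k div 3"
    have m: "k = 3 * m + 1" using mod1(1) mult_div_mod_eq[of 3 k] unfolding m_def by linarith
    hence "m \<le> l" "m \<noteq> 0" using mod1(2) k3 by simp_all
    thus ?thesis
      by (intro witness[of "{..<m}" "m - 1" 0 0]) (use m l k(1) in simp_all)
  next
    case mod2
    have "k = 3 * (k div 3) + 2" using mod2(1) mult_div_mod_eq[of 3 k] by linarith
    then obtain m where m: "k = 3 * m + 5" using k3 by (cases "k div 3") simp_all
    hence "m + 2 \<le> l" "m \<noteq> 0" using mod2(2) k(2) by (auto intro: odd_pos)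
    \<comment> \<open>As \<open>m + 1 < l\<close>, the extra vertex has no neighbour in the interval
      and adds 4 to \<open>3 * m + 1\<close>.\<close>
    thus ?thesis
      by (intro witness[of "insert (m + 1) {..<m}" "m - 1" 0 0]) (use m l k(1) in simp_all)
  next
    case mod2'
    \<comment> \<open>The previous choice would now add the vertex \<open>l\<close>, a neighbour of
      \<open>0\<close>; \<open>2 * l - 1\<close> has no neighbour in the interval.\<close>
    have "l - 1 \<le> 2 * l - 1" "card (insert (2 * l - 1) {..<l - 1}) = l" using l by auto
    thus ?thesis
      by (intro witness[of "insert (2 * l - 1) {..<l - 1}" "l - 2" 0 0]) (use mod2' l in auto)
  next
    case mod0
    have "k = 3 * (k div 3)" using mod0(1) mult_div_mod_eq[of 3 k] by linarith
    then obtain m where m: "k = 3 * m + 3" using k3 by (cases "k div 3") simp_all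
    hence m': "m + 2 \<le> l" "m \<noteq> 0" using mod0(2) k3 by auto
    hence "card (insert (k - l) {..<m}) = m + 1" "m \<le> k - l" using k(1) by auto
    \<comment> \<open>\<open>k - l\<close> is joined to \<open>0\<close> and to
      \<open>k - 2 * l < m\<close>, so it adds 2 to \<open>3 * m + 1\<close>.\<close>
    thus ?thesis
      by (intro witness[of "insert (k - l) {..<m}" "m - 1" 1 1]) (use m m' l k(1) in auto)
  next
    case mod0'
    have "even l" "l \<noteq> 2" using k(2,3) mod0' by auto
    hence "4 \<le> l" using l by (cases "l = 3") auto
    then obtain r where r: "l = r + 4" by (metis le_add_diff_inverse2)
    \<comment> \<open>An interval of \<open>l - 3\<close> vertices with the isolated vertices
      \<open>l - 2\<close> and \<open>2 * l - 1\<close> meets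
      \<open>3 * (l - 3) + 1 + 8 = 3 * l\<close> edges.\<close>
    let ?U = "insert (2 * r + 7) (insert (r + 2) {..<r + 1})"
    have gap: "gap_count ?U d = r + 1 - d + of_bool (d \<le> r + 2 \<and> r + 2 < r + 1 + d)
        + of_bool (d \<le> 2 * r + 7 \<and> (2 * r + 7 - d = r + 2 \<or> 2 * r + 7 - d < r + 1))" if "0 < d" for d
      using that by (subst gap_count_insert) auto
    have kl: "k = 3 * r + 12" "k - 1 = 3 * r + 11" "k - l = 2 * r + 8" using mod0' r by simp_all
    show ?thesis
    proof (rule witness[of ?U r 0 0])
      show "?U \<subseteq> {..<k}" using kl(1) by auto
      show "gap_count ?U 1 = r" using gap[of 1] by simp
      show "gap_count ?U (k - 1) = 0" using gap[of "k - 1"] unfolding kl(2) by simp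
      show "gap_count ?U l = 0" using gap[of l] unfolding r by simp
      show "gap_count ?U (k - l) = 0" using gap[of "k - l"] unfolding kl(3) by simp
      have "card ?U = r + 3" by simp
      thus "4 * card ?U = k + r + 0 + 0" using kl(1) by simp
    qed
  qed
qed

lemma balanceable_chorded_cycle_le:
  assumes l: "l \<in> {2..k - 2}" and k: "k > 3" "2 * l \<le> k"
  shows "balanceable (chorded_cycle k l) \<longleftrightarrow> even k \<and> (k, l) \<noteq> (6, 2)"
proof
  show "even k \<and> (k, l) \<noteq> (6, 2)" if "balanceable (chorded_cycle k l)"
    using that not_balanceable_odd[OF l k(1)] not_balanceable_6_2 by auto
next
  assume even: "even k \<and> (k, l) \<noteq> (6, 2)"
  hence "\<exists>W. half_edges (chorded_cycle k l) (inner_edges (chorded_cycle k l) W)"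
    using exists_half_inner_eq[OF l] exists_half_inner_less[OF l] k(2) by (cases "2 * l = k") auto
  thus "balanceable (chorded_cycle k l)"
    using exists_half_cut[OF l k(2)] even balanceableI[OF simple_graph_chorded_cycle[OF k(1) l]] by blast
qed

theorem theorem11:
  fixes k l :: nat
  assumes "k > 3" and "l \<in> {2..k - 2}"
  shows "balanceable (chorded_cycle k l) \<longleftrightarrow> even k \<and> (k, l) \<notin> {(6, 2), (6, 4)}"
proof (cases "2 * l \<le> k")
  case True
  hence "(k, l) \<noteq> (6, 4)" by auto
  thus ?thesis using balanceable_chorded_cycle_le[OF assms(2,1) True] by simp
next
  case False
  \<comment> \<open>Replacing \<open>l\<close> by \<open>k - l\<close> leaves the graph unchanged;
    the exception \<open>(6, 4)\<close> is the mirror image of \<open>(6, 2)\<close>.\<close>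
  have "k - l \<in> {2..k - 2}" "2 * (k - l) \<le> k" using assms False by auto
  from balanceable_chorded_cycle_le[OF this(1) assms(1) this(2)]
  have bal: "balanceable (chorded_cycle k l) \<longleftrightarrow> even k \<and> (k, k - l) \<noteq> (6, 2)"
    by (simp add: chorded_cycle_symmetric[OF assms(2)])
  have "(k, k - l) \<noteq> (6, 2) \<longleftrightarrow> (k, l) \<notin> {(6, 2), (6, 4)}"
    using False by (cases "k = 6") auto
  from bal[unfolded this] show ?thesis .
qed

end
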